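(* In the setting and notation described in the context, let $k\ge0$. If $$F(\mathbf{x}_{k+1})\le F(\mathbf{z}_{k+1})\le Q_{L_{k+1},\mathbf{y}_{k+1}}(\mathbf{z}_{k+1})+\Psi(\mathbf{z}_{k+1}),$$ then $$\Delta_{k+1}+\mathcal{A}_{k+1}+\mathcal{B}_{k+1}\le\Delta_k,$$ where $$\mathcal{A}_{k+1}=\frac12\left(\frac{A_{k+1}}{L_{k+1}+\mu_\Psi}-\frac{a_{k+1}^2}{\gamma_{k+1}}\right)\|\mathbf{g}_{k+1}\|_2^2,\qquad \mathcal{B}_{k+1}=\frac1{\gamma_{k+1}}\left\langle\mathbf{g}_{k+1}-\frac{\mu}{2Y_{k+1}}\mathbf{s}_{k+1},\ \mathbf{s}_{k+1}\right\rangle,$$ $$\mathbf{g}_{k+1}=(L_{k+1}+\mu_\Psi)(\mathbf{y}_{k+1}-\mathbf{z}_{k+1}),\qquad \mathbf{s}_{k+1}=A_k\gamma_{k+1}\mathbf{x}_k+a_{k+1}\gamma_k\mathbf{v}_k-Y_{k+1}\mathbf{y}_{k+1},$$ $$Y_{k+1}=A_k\gamma_{k+1}+a_{k+1}\gamma_k .$$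
   Context: $f:\mathbb{R}^n\to\mathbb{R}$ is convex and differentiable with Lipschitz gradient and strong convexity parameter $\mu_f\ge0$ ($f-\frac{\mu_f}{2}\|\cdot\|_2^2$ convex); $\Psi:\mathbb{R}^n\to\mathbb{R}\cup\{+\infty\}$ is convex, lower semicontinuous, not identically $+\infty$, with strong convexity parameter $\mu_\Psi\ge0$ ($\Psi-\frac{\mu_\Psi}{2}\|\cdot\|_2^2$ convex). $F=f+\Psi$, $\mu=\mu_f+\mu_\Psi$; a minimizer of $F$ is assumed to exist and $\mathbf{x}^*$ is a fixed one. $Q_{\lambda,\mathbf{y}}(\mathbf{x})=f(\mathbf{y})+\langle\nabla f(\mathbf{y}),\mathbf{x}-\mathbf{y}\rangle+\frac{\lambda}{2}\|\mathbf{x}-\mathbf{y}\|_2^2$, and $T_L(\mathbf{y})=\arg\min_{\mathbf{x}}(Q_{L,\mathbf{y}}(\mathbf{x})+\Psi(\mathbf{x}))$ for $L>0$. Sequences: $A_0\ge0$, $\gamma_0>0$, $\mathbf{v}_0=\mathbf{x}_0\in\mathbb{R}^n$; for $k\ge0$, given $a_{k+1}>0$, $L_{k+1}>0$, $\mathbf{y}_{k+1}\in\mathbb{R}^n$ and a main iterate $\mathbf{x}_{k+1}\in\mathbb{R}^n$, $$\mathbf{z}_{k+1}=T_{L_{k+1}}(\mathbf{y}_{k+1}),\quad A_{k+1}=A_k+a_{k+1},\quad \gamma_{k+1}=\gamma_k+a_{k+1}\mu,$$ $$\mathbf{v}_{k+1}=\frac1{\gamma_{k+1}}\bigl(\gamma_k\mathbf{v}_k+a_{k+1}(L_{k+1}+\mu_\Psi)\mathbf{z}_{k+1}-a_{k+1}(L_{k+1}-\mu_f)\mathbf{y}_{k+1}\bigr).$$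 The gap sequence is $\Delta_k=A_k(F(\mathbf{x}_k)-F(\mathbf{x}^* ))+\frac{\gamma_k}{2}\|\mathbf{v}_k-\mathbf{x}^*\|_2^2$, $k\ge0$. Conventions: $F(\mathbf{x}_k)<\infty$ for $k\ge1$; $F(\mathbf{x}_0)<\infty$ if $A_0>0$; if $A_0=0$, any term multiplied by $A_0$ is read as $0$. *)

theory Defs
  imports "HOL-Analysis.Analysis"
begin

text \<open>
  Functions into \<open>\<real> \<union> {+\<infinity>}\<close> are rendered as \<^typ>\<open>ereal\<close>-valued functions that never take the
  value \<open>-\<infinity>\<close>.  For those, the right-hand side below is never of the form \<open>\<infinity> - \<infinity>\<close>, and
  \<open>0 * \<infinity> = 0\<close> makes the degenerate weights harmless.
\<close>

definition ereal_convex :: "('a::real_vector \<Rightarrow> ereal) \<Rightarrow> bool" where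
  "ereal_convex h \<longleftrightarrow>
     (\<forall>x y. \<forall>u\<ge>0. \<forall>v\<ge>0. u + v = 1 \<longrightarrow>
        h (u *\<^sub>R x + v *\<^sub>R y) \<le> ereal u * h x + ereal v * h y)"

definition lower_semicont :: "('a::topological_space \<Rightarrow> ereal) \<Rightarrow> bool" where
  "lower_semicont h \<longleftrightarrow> (\<forall>x. h x \<le> Liminf (at x) h)"

definition grad :: "('a::real_inner \<Rightarrow> real) \<Rightarrow> 'a \<Rightarrow> 'a" where
  "grad f x = (THE D. GDERIV f x :> D)"

definition Qmodel :: "('a::real_inner \<Rightarrow> real) \<Rightarrow> real \<Rightarrow> 'a \<Rightarrow> 'a \<Rightarrow> real" where
  "Qmodel f l y x = f y + inner (grad f y) (x - y) + l / 2 * (norm (x - y))\<^sup>2"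

text \<open>
  For \<open>L > 0\<close> and \<open>\<Psi>\<close> proper, convex and lower semicontinuous on a finite-dimensional space, the
  objective has exactly one minimizer, so the choice made by \<^const>\<open>arg_min\<close> is immaterial.
\<close>

definition Tprox ::
    "('a::real_inner \<Rightarrow> real) \<Rightarrow> ('a \<Rightarrow> ereal) \<Rightarrow> real \<Rightarrow> 'a \<Rightarrow> 'a" where
  "Tprox f \<Psi> L y = arg_min (\<lambda>x. ereal (Qmodel f L y x) + \<Psi> x) (\<lambda>_. True)"

end

theory Submission
  imports Defs
begin

text \<open>
  The model objective \<open>\<phi> = Q\<^bsub>L,y\<^esub> + \<Psi>\<close> is strongly convex with modulus \<open>M = L + \<mu>\<Psi>\<close>, so at its
  minimizer \<open>z\<close> it grows quadratically: \<open>\<phi> u \<ge> \<phi> z + M/2 |u - z|\<^sup>2\<close>.  Two comparisons turn this into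
  a lower bound on \<open>F\<close>.  On the left, strong convexity of \<open>f\<close> gives
  \<open>F u \<ge> \<phi> u - (L - \<mu>f)/2 |u - y|\<^sup>2\<close>; on the right, the descent hypotheses give \<open>\<phi> z \<ge> F x'\<close> for the new main
  iterate \<open>x'\<close>.  With \<open>g = M (y - z)\<close> the quadratics combine to
  \<open>F u \<ge> F x' + |g|\<^sup>2/(2M) + \<langle>g, u - y\<rangle> + \<mu>/2 |u - y|\<^sup>2\<close> for all \<open>u\<close>,
  which is lemma \<open>composite_gradient_lower_bound\<close>.

  Taking \<open>A\<^sub>k\<close> times this bound at \<open>u = x\<^sub>k\<close> plus \<open>a\<close> times the bound at \<open>u = x\<^sup>*\<close> yields the function
  value part of the gap inequality, together with the first part of \<open>\<A>\<close>.  What remains, lemma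
  \<open>estimate_function_update\<close>, is an inequality between quadratic forms.  Relative to \<open>y\<close>, the update
  of \<open>v\<close> reads \<open>\<gamma>' (v' - y) = \<gamma> (v - y) - a g\<close>, that is, \<open>v'\<close> minimizes the quadratic
  \<open>p \<mapsto> \<gamma>/2 |p - v|\<^sup>2 + a (\<langle>g, p - y\<rangle> + \<mu>/2 |p - y|\<^sup>2)\<close> of curvature \<open>\<gamma>' = \<gamma> + a \<mu>\<close>.  Completing the
  square there absorbs every term containing \<open>x\<^sup>*\<close>.  It produces the second part of \<open>\<A>\<close>, the terms
  linear in \<open>g\<close> add up to \<open>\<langle>g, s\<rangle> / \<gamma>'\<close>, and the curvature terms that are left have the right sign.

  The growth bound speaks about a minimizer, so the value chosen by \<^const>\<open>Tprox\<close> has to be shown to be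
  one.  This rests on lower semicontinuity, compactness of balls, and the fact that strong convexity
  confines the sublevel sets of \<open>\<phi>\<close> to a ball.
\<close>

section \<open>Strongly convex extended-valued functions\<close>

text \<open>
  The values at the end points are required to be real, which keeps differences of infinities out of
  the inequality.
\<close>

definition strongly_convex_ereal :: "real \<Rightarrow> ('a::real_normed_vector \<Rightarrow> ereal) \<Rightarrow> bool" where
  "strongly_convex_ereal m h \<longleftrightarrow>
     (\<forall>u w p q t. h u = ereal p \<longrightarrow> h w = ereal q \<longrightarrow> 0 \<le> t \<longrightarrow> t \<le> 1 \<longrightarrow>
        h ((1 - t) *\<^sub>R u + t *\<^sub>R w)
          \<le> ereal ((1 - t) * p + t * q - m / 2 * (t * (1 - t)) * (norm (u - w))\<^sup>2))"

lemma norm_sq_convex_combination: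
  fixes u w :: "'a::real_inner"
  shows "(norm ((1 - t) *\<^sub>R u + t *\<^sub>R w))\<^sup>2
    = (1 - t) * (norm u)\<^sup>2 + t * (norm w)\<^sup>2 - t * (1 - t) * (norm (u - w))\<^sup>2"
  unfolding power2_norm_eq_inner
  by (simp add: inner_add_left inner_add_right inner_diff_left
      inner_diff_right inner_commute[of w u] algebra_simps)

lemma strongly_convex_erealI:
  fixes h :: "'a::real_inner \<Rightarrow> ereal"
  assumes "ereal_convex (\<lambda>u. h u - ereal (m / 2 * (norm u)\<^sup>2))"
  shows "strongly_convex_ereal m h"
  unfolding strongly_convex_ereal_def
proof (intro allI impI)
  fix u w p q and t :: real
  assume hu: "h u = ereal p" and hw: "h w = ereal q" and t: "0 \<le> t" "t \<le> 1"
  let ?c = "(1 - t) *\<^sub>R u + t *\<^sub>R w"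
  have "h ?c - ereal (m / 2 * (norm ?c)\<^sup>2)
      \<le> ereal (1 - t) * (h u - ereal (m / 2 * (norm u)\<^sup>2)) + ereal t * (h w - ereal (m / 2 * (norm w)\<^sup>2))"
    using assms[unfolded ereal_convex_def, rule_format, of "1 - t" t u w] t by simp
  then have "h ?c \<le> ereal ((1 - t) * (p - m / 2 * (norm u)\<^sup>2) + t * (q - m / 2 * (norm w)\<^sup>2)
      + m / 2 * (norm ?c)\<^sup>2)"
    unfolding hu hw by (cases "h ?c") (auto simp: algebra_simps)
  also have "(1 - t) * (p - m / 2 * (norm u)\<^sup>2) + t * (q - m / 2 * (norm w)\<^sup>2) + m / 2 * (norm ?c)\<^sup>2
      = (1 - t) * p + t * q - m / 2 * (t * (1 - t)) * (norm (u - w))\<^sup>2"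
    unfolding norm_sq_convex_combination by (simp add: field_simps)
  finally show "h ?c \<le> ereal ((1 - t) * p + t * q - m / 2 * (t * (1 - t)) * (norm (u - w))\<^sup>2)" .
qed

text \<open>
  In \<^const>\<open>Qmodel\<close> the affine part is respected exactly by convex combinations, while the quadratic
  part satisfies the strong convexity inequality with equality; hence the moduli add.
\<close>
lemma strongly_convex_ereal_Qmodel_add:
  assumes "strongly_convex_ereal m h"
  shows "strongly_convex_ereal (l + m) (\<lambda>u. ereal (Qmodel f l y u) + h u)"
  unfolding strongly_convex_ereal_def
proof (intro allI impI)
  fix u w p q and t :: real
  assume hu: "ereal (Qmodel f l y u) + h u = ereal p"
    and hw: "ereal (Qmodel f l y w) + h w = ereal q" and t: "0 \<le> t" "t \<le> 1"
  let ?c = "(1 - t) *\<^sub>R u + t *\<^sub>R w"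
  define p' q' where "p' = p - Qmodel f l y u" and "q' = q - Qmodel f l y w"
  have hu': "h u = ereal p'" using hu by (cases "h u") (auto simp: p'_def)
  have hw': "h w = ereal q'" using hw by (cases "h w") (auto simp: q'_def)
  have c: "?c - y = (1 - t) *\<^sub>R (u - y) + t *\<^sub>R (w - y)"
    by (simp add: algebra_simps)
  have "Qmodel f l y ?c = (1 - t) * Qmodel f l y u + t * Qmodel f l y w
      - l / 2 * (t * (1 - t)) * (norm (u - w))\<^sup>2"
  proof -
    have i: "inner (grad f y) (?c - y)
        = (1 - t) * inner (grad f y) (u - y) + t * inner (grad f y) (w - y)"
      unfolding c by (simp add: inner_add_right)
    have n: "(norm (?c - y))\<^sup>2
        = (1 - t) * (norm (u - y))\<^sup>2 + t * (norm (w - y))\<^sup>2 - t * (1 - t) * (norm (u - w))\<^sup>2"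
      unfolding c norm_sq_convex_combination by simp
    show ?thesis unfolding Qmodel_def i n by argo
  qed
  moreover have "h ?c \<le> ereal ((1 - t) * p' + t * q' - m / 2 * (t * (1 - t)) * (norm (u - w))\<^sup>2)"
    using assms hu' hw' t unfolding strongly_convex_ereal_def by blast
  ultimately show "ereal (Qmodel f l y ?c) + h ?c
      \<le> ereal ((1 - t) * p + t * q - (l + m) / 2 * (t * (1 - t)) * (norm (u - w))\<^sup>2)"
    by (cases "h ?c") (auto simp: p'_def q'_def field_simps)
qed

text \<open>
  Compare \<open>h z\<close> with the value of \<open>h\<close> at a point close to \<open>z\<close> on the segment towards \<open>u\<close>: after
  division by the parameter \<open>t\<close> of that point only a factor \<open>1 - t\<close> is lost in the quadratic term, and
  it disappears as \<open>t\<close> tends to \<open>0\<close>.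
\<close>
lemma strongly_convex_ereal_minimizer_growth:
  assumes sc: "strongly_convex_ereal m h"
    and min: "\<And>u. h z \<le> h u" and z: "h z = ereal p" and u: "h u = ereal q"
  shows "p + m / 2 * (norm (u - z))\<^sup>2 \<le> q"
proof -
  have "p + m / 2 * (1 - t) * (norm (u - z))\<^sup>2 \<le> q" if t: "0 < t" "t < 1" for t
  proof -
    have "h ((1 - t) *\<^sub>R z + t *\<^sub>R u)
        \<le> ereal ((1 - t) * p + t * q - m / 2 * (t * (1 - t)) * (norm (z - u))\<^sup>2)"
      using sc z u t unfolding strongly_convex_ereal_def by auto
    with min[of "(1 - t) *\<^sub>R z + t *\<^sub>R u"]
    have "p \<le> (1 - t) * p + t * q - m / 2 * (t * (1 - t)) * (norm (z - u))\<^sup>2"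
      unfolding z using order_trans ereal_less_eq(3) by blast
    then have "t * (p + m / 2 * (1 - t) * (norm (u - z))\<^sup>2) \<le> t * q"
      by (simp add: algebra_simps norm_minus_commute)
    with t show ?thesis by simp
  qed
  then have "\<forall>\<^sub>F t in at_right 0. p + m / 2 * (1 - t) * (norm (u - z))\<^sup>2 \<le> q"
    unfolding eventually_at_right_field by (intro exI[of _ 1]) auto
  moreover have "((\<lambda>t. p + m / 2 * (1 - t) * (norm (u - z))\<^sup>2)
      \<longlongrightarrow> p + m / 2 * (1 - 0) * (norm (u - z))\<^sup>2) (at_right 0)"
    by (intro tendsto_intros)
  ultimately show ?thesis
    using tendsto_upperbound[of "\<lambda>t. p + m / 2 * (1 - t) * (norm (u - z))\<^sup>2" _ "at_right 0"] by simp
qed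

section \<open>Existence of minimizers\<close>

lemma lower_semicont_iff_eventually:
  "lower_semicont h \<longleftrightarrow> (\<forall>x c. c < h x \<longrightarrow> (\<forall>\<^sub>F u in nhds x. c < h u))"
  unfolding lower_semicont_def le_Liminf_iff eventually_nhds_conv_at by blast

lemma lower_semicont_add_continuous:
  fixes q :: "'a::t2_space \<Rightarrow> real"
  assumes q: "continuous_on UNIV q" and h: "lower_semicont h"
  shows "lower_semicont (\<lambda>u. ereal (q u) + h u)"
  unfolding lower_semicont_iff_eventually
proof (intro allI impI)
  fix x c assume c: "c < ereal (q x) + h x"
  then have "c - ereal (q x) < h x"
    by (cases c; cases "h x") auto
  then obtain d where d: "c - ereal (q x) < ereal d" "ereal d < h x"
    using ereal_dense2 by blast
  have "\<forall>\<^sub>F u in nhds x. ereal d < h u"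
    using h d(2) unfolding lower_semicont_iff_eventually by blast
  moreover have "\<forall>\<^sub>F u in nhds x. c < ereal (q u + d)"
  proof -
    have "isCont q x" using q by (simp add: continuous_on_eq_continuous_at)
    then have "((\<lambda>u. ereal (q u + d)) \<longlongrightarrow> ereal (q x + d)) (nhds x)"
      unfolding isCont_def tendsto_at_iff_tendsto_nhds by (intro tendsto_intros)
    moreover have "c < ereal (q x + d)" using d(1) by (cases c) auto
    ultimately show ?thesis by (rule order_tendstoD(1))
  qed
  ultimately show "\<forall>\<^sub>F u in nhds x. c < ereal (q u) + h u"
  proof eventually_elim
    case (elim u)
    then show ?case by (cases "h u"; cases c) auto
  qed
qed

text \<open>
  If no point of \<open>S\<close> were minimal, each \<open>z\<close> would be beaten by some \<open>b z\<close>, and by semicontinuity so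
  would a whole neighbourhood of \<open>z\<close>.  Finitely many of these neighbourhoods cover \<open>S\<close>, and the best of the
  corresponding \<open>b z\<close> lies in one of them, so it would be beaten by another one of them.
\<close>
lemma lower_semicont_attains_min:
  assumes h: "lower_semicont h" and S: "compact S" "S \<noteq> {}"
  shows "\<exists>z\<in>S. \<forall>u\<in>S. h z \<le> h u"
proof (rule ccontr)
  assume "\<not> ?thesis"
  then have "\<exists>w\<in>S. h w < h z" if "z \<in> S" for z using that by (force simp: not_le)
  then obtain b where b: "\<And>z. z \<in> S \<Longrightarrow> b z \<in> S \<and> h (b z) < h z" by metis
  have "\<exists>U. open U \<and> z \<in> U \<and> (\<forall>u\<in>U. h (b z) < h u)" if "z \<in> S" for z
    using h b[OF that] unfolding lower_semicont_iff_eventually eventually_nhds by blast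
  then obtain U where U: "\<And>z. z \<in> S \<Longrightarrow> open (U z) \<and> z \<in> U z \<and> (\<forall>u\<in>U z. h (b z) < h u)" by metis
  then obtain D where D: "D \<subseteq> S" "finite D" "S \<subseteq> (\<Union>z\<in>D. U z)"
    using compactE_image[OF S(1), of S U] by (metis UN_I subsetI)
  with S(2) have "D \<noteq> {}" by auto
  then have "Min ((\<lambda>z. h (b z)) ` D) \<in> (\<lambda>z. h (b z)) ` D" using D(2) by (intro Min_in) auto
  then obtain z where "z \<in> D" "h (b z) = Min ((\<lambda>z. h (b z)) ` D)" by auto
  then have z: "z \<in> D" "\<And>z'. z' \<in> D \<Longrightarrow> h (b z) \<le> h (b z')"
    using D(2) by auto
  have "b z \<in> S" using b z(1) D(1) by blast
  then obtain z' where "z' \<in> D" "b z \<in> U z'" using D(3) by blast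
  then show False using U z(2)[of z'] D(1) by (metis leD subsetD)
qed

text \<open>
  Let \<open>b\<close> be the minimum of \<open>h\<close> on the unit ball around a point \<open>u0\<close> with finite value \<open>p\<close>.  A point at
  distance \<open>r > 1\<close> from \<open>u0\<close> with value below \<open>p\<close> would, by strong convexity, push the value on the unit
  sphere down to \<open>p - m/2 (r - 1)\<close>, which cannot lie below \<open>b\<close>.  So \<open>r\<close> is bounded, and the search for
  a minimizer is confined to a compact ball.
\<close>
lemma strongly_convex_ereal_minimizer_exists:
  fixes h :: "'a::euclidean_space \<Rightarrow> ereal"
  assumes sc: "strongly_convex_ereal m h" and m: "0 < m" and lsc: "lower_semicont h"
    and not_minf: "\<And>u. h u \<noteq> -\<infinity>" and proper: "\<exists>u. h u \<noteq> \<infinity>"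
  shows "\<exists>z. \<forall>u. h z \<le> h u"
proof -
  obtain u0 p where p: "h u0 = ereal p"
    using proper not_minf by (metis ereal_cases)
  obtain w0 where w0: "w0 \<in> cball u0 1" "\<And>w. w \<in> cball u0 1 \<Longrightarrow> h w0 \<le> h w"
    using lower_semicont_attains_min[OF lsc compact_cball, of u0 1] by auto
  have "h w0 \<le> h u0" using w0(2) by simp
  then obtain b where b: "h w0 = ereal b"
    using p not_minf[of w0] by (cases "h w0") auto
  define R where "R = 1 + 2 * (p - b) / m"
  have R: "1 \<le> R" using \<open>h w0 \<le> h u0\<close> b p m by (simp add: R_def)
  have outside: "h u0 \<le> h u" if u: "R < norm (u - u0)" for u
  proof (rule ccontr)
    assume "\<not> ?thesis"
    then have lt: "h u < ereal p" using p by simp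
    then obtain q where q: "h u = ereal q" "q < p" using not_minf[of u] by (cases "h u") auto
    define r where "r = norm (u - u0)"
    have r: "1 < r" "R < r" using R u by (auto simp: r_def)
    \<comment> \<open>the point where the segment from \<open>u0\<close> to \<open>u\<close> crosses the unit sphere\<close>
    let ?w = "(1 - 1 / r) *\<^sub>R u0 + (1 / r) *\<^sub>R u"
    have "1 / r \<le> 1" using r(1) by simp
    have "?w - u0 = (1 / r) *\<^sub>R (u - u0)" by (simp add: algebra_simps)
    then have "norm (?w - u0) = 1 / r * r" using r(1) by (simp only: norm_scaleR r_def) simp
    then have "norm (?w - u0) = 1" using r(1) by simp
    then have "ereal b \<le> h ?w" using w0(2)[of ?w] b by (simp add: dist_norm norm_minus_commute)
    also have "h ?w \<le> ereal ((1 - 1 / r) * p + 1 / r * q - m / 2 * (1 / r * (1 - 1 / r)) * r\<^sup>2)"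
      unfolding r_def[unfolded norm_minus_commute[of u u0]]
      by (rule sc[unfolded strongly_convex_ereal_def, rule_format, OF p q(1)])
        (use \<open>1 / r \<le> 1\<close> r(1) in \<open>simp_all add: r_def norm_minus_commute\<close>)
    finally have "b \<le> (1 - 1 / r) * p + 1 / r * q - m / 2 * (1 / r * (1 - 1 / r)) * r\<^sup>2" by simp
    also have "m / 2 * (1 / r * (1 - 1 / r)) * r\<^sup>2 = m / 2 * (r - 1)"
      using r by (simp add: field_simps power2_eq_square)
    also have "(1 - 1 / r) * p + 1 / r * q = p - 1 / r * (p - q)" by argo
    also have "\<dots> \<le> p" using q(2) r(1) by simp
    finally have "m / 2 * (r - 1) \<le> p - b" by simp
    then have "r \<le> R" using m by (simp add: R_def field_simps)
    with r show False by simp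
  qed
  have "cball u0 R \<noteq> {}" using R by simp
  then obtain z where z: "\<And>u. u \<in> cball u0 R \<Longrightarrow> h z \<le> h u"
    using lower_semicont_attains_min[OF lsc compact_cball] by blast
  have "h z \<le> h u" for u
  proof (cases "u \<in> cball u0 R")
    case False
    then have "h u0 \<le> h u" by (intro outside) (simp add: dist_norm norm_minus_commute)
    moreover have "h z \<le> h u0" using z[of u0] R by simp
    ultimately show ?thesis by simp
  qed (rule z)
  then show ?thesis by blast
qed

section \<open>Gradients and tangent bounds\<close>

text \<open>The Riesz representative of the derivative, written out in the standard basis.\<close>
lemma GDERIV_grad:
  fixes f :: "'a::euclidean_space \<Rightarrow> real"
  assumes "f differentiable (at x)"
  shows "GDERIV f x :> grad f x"
proof -
  obtain f' where f': "(f has_derivative f') (at x)"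
    using assms by (auto simp: differentiable_def)
  interpret bounded_linear f' using f' by (rule has_derivative_bounded_linear)
  let ?D = "\<Sum>b\<in>Basis. f' b *\<^sub>R b"
  have "f' h = inner h ?D" for h
  proof -
    have "f' h = f' (\<Sum>b\<in>Basis. (inner h b) *\<^sub>R b)" by (simp add: euclidean_representation)
    also have "\<dots> = inner h ?D" by (simp add: sum scaleR inner_sum_right mult.commute)
    finally show ?thesis .
  qed
  note rep = this
  have D: "GDERIV f x :> ?D"
    using f' unfolding gderiv_def by (rule has_derivative_eq_rhs) (rule ext, rule rep)
  moreover have "E = ?D" if "GDERIV f x :> E" for E
    using has_derivative_unique[OF that[unfolded gderiv_def] D[unfolded gderiv_def]]
    by (simp add: fun_eq_iff vector_eq_ldot)
  ultimately show ?thesis unfolding grad_def by (rule theI)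
qed

lemma convex_on_above_tangent_GDERIV:
  fixes f :: "'a::real_inner \<Rightarrow> real"
  assumes cv: "convex_on UNIV f" and D: "GDERIV f y :> D"
  shows "f y + inner D (u - y) \<le> f u"
proof -
  let ?g = "\<lambda>t::real. f (y + t *\<^sub>R (u - y))"
  have "convex_on UNIV ?g"
  proof (rule convex_onI)
    fix t r s :: real assume "0 < t" "t < 1"
    moreover have "y + ((1 - t) *\<^sub>R r + t *\<^sub>R s) *\<^sub>R (u - y)
        = (1 - t) *\<^sub>R (y + r *\<^sub>R (u - y)) + t *\<^sub>R (y + s *\<^sub>R (u - y))"
      by (simp add: algebra_simps)
    ultimately show "?g ((1 - t) *\<^sub>R r + t *\<^sub>R s) \<le> (1 - t) * ?g r + t * ?g s"
      using cv by (simp add: convex_onD)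
  qed simp
  moreover have "(?g has_real_derivative inner D (u - y)) (at 0)"
  proof -
    have "((\<lambda>t. y + t *\<^sub>R (u - y)) has_derivative (\<lambda>t. t *\<^sub>R (u - y))) (at 0)"
      by (auto intro!: derivative_eq_intros)
    from has_derivative_compose[OF this, of f "\<lambda>h. inner h D"] D
    show ?thesis
      by (simp add: gderiv_def has_field_derivative_def inner_commute mult.commute[of _ "inner _ _"])
  qed
  ultimately have "inner D (u - y) * (1 - 0) \<le> ?g 1 - ?g 0"
    by (intro convex_on_imp_above_tangent[where A = UNIV]) auto
  then show ?thesis by simp
qed

text \<open>
  The tangent bound for the convex function \<open>f - m/2 |\<cdot>|\<^sup>2\<close>, whose gradient at \<open>y\<close> is
  \<open>grad f y - m y\<close>; the leftover squares assemble to \<open>m/2 |u - y|\<^sup>2\<close>.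
\<close>
lemma strongly_convex_above_tangent:
  fixes f :: "'a::euclidean_space \<Rightarrow> real"
  assumes cv: "convex_on UNIV (\<lambda>u. f u - m / 2 * (norm u)\<^sup>2)" and d: "f differentiable (at y)"
  shows "f y + inner (grad f y) (u - y) + m / 2 * (norm (u - y))\<^sup>2 \<le> f u"
proof -
  have "((\<lambda>u. m / 2 * (norm u)\<^sup>2) has_derivative (\<lambda>h. inner h (m *\<^sub>R y))) (at y)"
    unfolding power2_norm_eq_inner
    by (auto intro!: derivative_eq_intros simp: inner_commute)
  then have "GDERIV (\<lambda>u. f u - m / 2 * (norm u)\<^sup>2) y :> grad f y - m *\<^sub>R y"
    using GDERIV_diff[OF GDERIV_grad[OF d]] by (simp add: gderiv_def)
  from convex_on_above_tangent_GDERIV[OF cv this, of u]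
  show ?thesis
    by (simp add: power2_norm_eq_inner inner_diff_left inner_diff_right inner_commute[of u y] field_simps)
qed

section \<open>The lower bound from a proximal step\<close>

lemma Tprox_minimizes:
  fixes \<Psi> :: "'a::euclidean_space \<Rightarrow> ereal"
  assumes L: "0 < L" and m: "0 \<le> m" and sc: "strongly_convex_ereal m \<Psi>"
    and lsc: "lower_semicont \<Psi>" and not_minf: "\<And>u. \<Psi> u \<noteq> -\<infinity>"
    and proper: "\<exists>u. \<Psi> u \<noteq> \<infinity>"
  shows "ereal (Qmodel f L y (Tprox f \<Psi> L y)) + \<Psi> (Tprox f \<Psi> L y)
    \<le> ereal (Qmodel f L y u) + \<Psi> u"
proof -
  let ?h = "\<lambda>u. ereal (Qmodel f L y u) + \<Psi> u"
  have "continuous_on UNIV (Qmodel f L y)"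
    unfolding Qmodel_def by (intro continuous_intros)
  then have "lower_semicont ?h" using lsc by (rule lower_semicont_add_continuous)
  moreover have "?h u \<noteq> -\<infinity>" for u using not_minf[of u] by (cases "\<Psi> u") auto
  moreover have "\<exists>u. ?h u \<noteq> \<infinity>" using proper not_minf by auto
  ultimately have "\<exists>z. \<forall>u. ?h z \<le> ?h u"
    using strongly_convex_ereal_minimizer_exists[OF strongly_convex_ereal_Qmodel_add[OF sc], of L f y] L m
    by simp
  then have "\<exists>z. is_arg_min ?h (\<lambda>_. True) z" by (auto simp: is_arg_min_def not_less)
  then have "is_arg_min ?h (\<lambda>_. True) (Tprox f \<Psi> L y)"
    unfolding Tprox_def arg_min_def by (rule someI_ex)
  then show ?thesis by (auto simp: is_arg_min_def not_less)
qed

text \<open>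
  The model objective grows from \<open>z\<close> with modulus \<open>M = L + \<mu>\<Psi>\<close>, and it overestimates \<open>f + \<Psi>\<close> by at
  most \<open>(L - \<mu>f)/2 |u - y|\<^sup>2\<close>; the two moduli differ by \<open>\<mu>f + \<mu>\<Psi>\<close>.  Re-centring the growth
  term \<open>M/2 |u - z|\<^sup>2\<close> from \<open>z\<close> to \<open>y\<close> produces the terms in \<open>g\<close>.
\<close>
lemma composite_gradient_lower_bound:
  fixes f :: "'a::euclidean_space \<Rightarrow> real" and \<Psi> :: "'a \<Rightarrow> ereal"
  assumes f_diff: "f differentiable (at y)"
    and f_strong: "convex_on UNIV (\<lambda>u. f u - \<mu>f / 2 * (norm u)\<^sup>2)"
    and sc: "strongly_convex_ereal \<mu>\<Psi> \<Psi>" and M: "0 < L + \<mu>\<Psi>"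
    and min: "\<And>w. ereal (Qmodel f L y z) + \<Psi> z \<le> ereal (Qmodel f L y w) + \<Psi> w"
    and z: "\<Psi> z = ereal pz" and u: "\<Psi> u = ereal pu"
    and descent: "Fx \<le> Qmodel f L y z + pz"
    and g: "g = (L + \<mu>\<Psi>) *\<^sub>R (y - z)"
  shows "Fx + (norm g)\<^sup>2 / (2 * (L + \<mu>\<Psi>)) + inner g (u - y) + (\<mu>f + \<mu>\<Psi>) / 2 * (norm (u - y))\<^sup>2
    \<le> f u + pu"
proof -
  let ?M = "L + \<mu>\<Psi>"
  have "Qmodel f L y z + pz + ?M / 2 * (norm (u - z))\<^sup>2 \<le> Qmodel f L y u + pu"
    by (rule strongly_convex_ereal_minimizer_growth[OF strongly_convex_ereal_Qmodel_add[OF sc] min])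
      (simp_all add: z u)
  moreover have "f y + inner (grad f y) (u - y) + \<mu>f / 2 * (norm (u - y))\<^sup>2 \<le> f u"
    by (rule strongly_convex_above_tangent[OF f_strong f_diff])
  moreover have "?M / 2 * (norm (u - z))\<^sup>2
      = (norm g)\<^sup>2 / (2 * ?M) + inner g (u - y) + ?M / 2 * (norm (u - y))\<^sup>2"
  proof -
    have "(norm (u - z))\<^sup>2 = (norm (y - z))\<^sup>2 + 2 * inner (y - z) (u - y) + (norm (u - y))\<^sup>2"
      unfolding power2_norm_eq_inner
      by (simp add: inner_diff_left inner_diff_right inner_commute[of z u] inner_commute[of z y] inner_commute[of u y])
    moreover have "(norm g)\<^sup>2 / (2 * ?M) = ?M / 2 * (norm (y - z))\<^sup>2"
    proof -
      have K: "K\<^sup>2 * X / (2 * K) = K / 2 * X" if "0 < K" for K X :: real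
        using that by (simp add: power2_eq_square)
      have "(norm g)\<^sup>2 = ?M\<^sup>2 * (norm (y - z))\<^sup>2"
        by (simp only: g norm_scaleR power_mult_distrib power2_abs)
      then show ?thesis by (simp only: K[OF M])
    qed
    ultimately show ?thesis by (simp add: g distrib_left)
  qed
  moreover have "?M / 2 * (norm (u - y))\<^sup>2
      = L / 2 * (norm (u - y))\<^sup>2 - \<mu>f / 2 * (norm (u - y))\<^sup>2
        + (\<mu>f + \<mu>\<Psi>) / 2 * (norm (u - y))\<^sup>2"
    by argo
  ultimately show ?thesis using descent unfolding Qmodel_def[of f L y u] by linarith
qed

section \<open>The update of the estimate function\<close>

text \<open>
  All points are taken relative to \<open>y\<close>: \<open>r\<close>, \<open>q\<close>, \<open>w\<close> and \<open>p\<close> stand for the old main iterate, the old and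
  the new estimate function vertex, and the minimizer of \<open>F\<close>; \<open>c\<close> and \<open>G\<close> are the old and the new
  curvature.  Since \<open>w\<close> minimizes the new estimate function, completing the square makes the dependence
  on \<open>p\<close> cancel.  The slack that is left consists of the curvature terms in \<open>|r|\<^sup>2\<close>, \<open>|q|\<^sup>2\<close> and
  \<open>|s|\<^sup>2\<close>, each of which has the right sign.
\<close>
lemma estimate_function_update:
  fixes r q p w g s :: "'a::real_inner"
  assumes G: "0 < G" and c: "0 < c" and a: "0 < a" and A: "0 \<le> A" and \<mu>: "0 \<le> \<mu>"
    and G': "G = c + a * \<mu>"
    and w: "G *\<^sub>R w = c *\<^sub>R q - a *\<^sub>R g"
    and Y: "Y = A * G + a * c"
    and s: "s = (A * G) *\<^sub>R r + (a * c) *\<^sub>R q"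
  shows "G / 2 * (norm (w - p))\<^sup>2 - a\<^sup>2 / (2 * G) * (norm g)\<^sup>2
           + 1 / G * inner (g - (\<mu> / (2 * Y)) *\<^sub>R s) s
       \<le> A * (inner g r + \<mu> / 2 * (norm r)\<^sup>2) + a * (inner g p + \<mu> / 2 * (norm p)\<^sup>2)
           + c / 2 * (norm (q - p))\<^sup>2"
proof -
  have "Y > 0" using assms by (simp add: add_nonneg_pos)
  then have 1: "0 \<le> \<mu> * (norm s)\<^sup>2 / (2 * Y * G)" using \<mu> G by simp
  have 2: "1 / G * inner (g - (\<mu> / (2 * Y)) *\<^sub>R s) s
      = A * inner g r + a * c / G * inner g q - \<mu> * (norm s)\<^sup>2 / (2 * Y * G)"
  proof -
    have "inner g s = A * G * inner g r + a * c * inner g q" by (simp add: s inner_add_right)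
    then show ?thesis using G \<open>Y > 0\<close>
      by (simp add: inner_diff_left power2_norm_eq_inner field_simps)
  qed
  have n: "G\<^sup>2 * (norm (w - p))\<^sup>2 = c\<^sup>2 * (norm q)\<^sup>2 + a\<^sup>2 * (norm g)\<^sup>2 + G\<^sup>2 * (norm p)\<^sup>2
      - 2 * a * c * inner g q - 2 * c * G * inner q p + 2 * a * G * inner g p"
  proof -
    have "G\<^sup>2 * (norm (w - p))\<^sup>2 = (norm (G *\<^sub>R w - G *\<^sub>R p))\<^sup>2"
      by (simp add: power_mult_distrib flip: scaleR_diff_right)
    also have "\<dots> = (norm (c *\<^sub>R q - a *\<^sub>R g - G *\<^sub>R p))\<^sup>2" by (simp add: w)
    also have "\<dots> = c * c * inner q q + a * a * inner g g + G * G * inner p p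
      - 2 * a * c * inner g q - 2 * c * G * inner q p + 2 * a * G * inner g p"
      unfolding power2_norm_eq_inner
      by (simp add: inner_diff_left inner_diff_right inner_commute[of q g]
        inner_commute[of p q] inner_commute[of p g] algebra_simps)
    finally show ?thesis by (simp only: power2_norm_eq_inner power2_eq_square[of c]
        power2_eq_square[of a] power2_eq_square[of G])
  qed
  have n': "(norm (q - p))\<^sup>2 = (norm q)\<^sup>2 - 2 * inner q p + (norm p)\<^sup>2"
    unfolding power2_norm_eq_inner
    by (simp add: inner_diff_left inner_diff_right inner_commute[of p q])
  have "G / 2 * (norm (w - p))\<^sup>2 - a\<^sup>2 / (2 * G) * (norm g)\<^sup>2 + a * c / G * inner g q
      + \<mu> / 2 * (a * c / G * (norm q)\<^sup>2)
     = (G\<^sup>2 * (norm (w - p))\<^sup>2 - a\<^sup>2 * (norm g)\<^sup>2 + 2 * a * c * inner g q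
        + \<mu> * a * c * (norm q)\<^sup>2) / (2 * G)"
    using G by (simp add: field_simps power2_eq_square[of G])
  also have "\<dots> = (G * (2 * a * inner g p + a * \<mu> * (norm p)\<^sup>2
        + c * ((norm q)\<^sup>2 - 2 * inner q p + (norm p)\<^sup>2))) / (2 * G)"
  proof -
    have "c\<^sup>2 + \<mu> * a * c = c * G" "G\<^sup>2 = G * (c + a * \<mu>)"
      by (simp_all add: G' power2_eq_square algebra_simps)
    then show ?thesis unfolding n by algebra
  qed
  also have "\<dots> = a * (inner g p + \<mu> / 2 * (norm p)\<^sup>2) + c / 2 * (norm (q - p))\<^sup>2"
    unfolding n' using G by (simp add: field_simps)
  finally have 3: "G / 2 * (norm (w - p))\<^sup>2 - a\<^sup>2 / (2 * G) * (norm g)\<^sup>2 + a * c / G * inner g q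
      + \<mu> / 2 * (a * c / G * (norm q)\<^sup>2)
     = a * (inner g p + \<mu> / 2 * (norm p)\<^sup>2) + c / 2 * (norm (q - p))\<^sup>2" .
  have "0 \<le> A * (\<mu> / 2 * (norm r)\<^sup>2)" "0 \<le> \<mu> / 2 * (a * c / G * (norm q)\<^sup>2)"
    using assms by auto
  with 1 2 3 show ?thesis unfolding distrib_left[of A] by linarith
qed


section \<open>Decrease of the gap sequence\<close>

theorem theorem2p4:
  fixes f :: "real ^ 'n \<Rightarrow> real"
    and \<Psi> :: "real ^ 'n \<Rightarrow> ereal"
    and \<mu>f \<mu>\<Psi> :: real
    and xs :: "real ^ 'n"
    and A \<gamma> a L :: "nat \<Rightarrow> real"
    and x y z v :: "nat \<Rightarrow> real ^ 'n"
    and k :: nat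
  defines "F \<equiv> \<lambda>u. ereal (f u) + \<Psi> u"
  defines "\<mu> \<equiv> \<mu>f + \<mu>\<Psi>"
  defines "\<Delta> \<equiv> \<lambda>j. ereal (A j) * (F (x j) - F xs)
                   + ereal (\<gamma> j / 2 * (norm (v j - xs))\<^sup>2)"
  defines "Y \<equiv> A k * \<gamma> (Suc k) + a (Suc k) * \<gamma> k"
  defines "g \<equiv> (L (Suc k) + \<mu>\<Psi>) *\<^sub>R (y (Suc k) - z (Suc k))"
  defines "s \<equiv> (A k * \<gamma> (Suc k)) *\<^sub>R x k + (a (Suc k) * \<gamma> k) *\<^sub>R v k - Y *\<^sub>R y (Suc k)"
  defines "\<A> \<equiv> 1 / 2 * (A (Suc k) / (L (Suc k) + \<mu>\<Psi>) - (a (Suc k))\<^sup>2 / \<gamma> (Suc k)) * (norm g)\<^sup>2"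
  defines "\<B> \<equiv> 1 / \<gamma> (Suc k) * inner (g - (\<mu> / (2 * Y)) *\<^sub>R s) s"
  assumes f_convex: "convex_on UNIV f"
    and f_diff: "\<forall>u. f differentiable (at u)"
    and f_lipschitz_grad: "\<exists>K. K-lipschitz_on UNIV (grad f)"
    and \<mu>f_nonneg: "\<mu>f \<ge> 0"
    and f_strong: "convex_on UNIV (\<lambda>u. f u - \<mu>f / 2 * (norm u)\<^sup>2)"
    and \<Psi>_not_minf: "\<forall>u. \<Psi> u \<noteq> -\<infinity>"
    and \<Psi>_proper: "\<exists>u. \<Psi> u \<noteq> \<infinity>"
    and \<Psi>_convex: "ereal_convex \<Psi>"
    and \<Psi>_lsc: "lower_semicont \<Psi>"
    and \<mu>\<Psi>_nonneg: "\<mu>\<Psi> \<ge> 0"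
    and \<Psi>_strong: "ereal_convex (\<lambda>u. \<Psi> u - ereal (\<mu>\<Psi> / 2 * (norm u)\<^sup>2))"
    and xs_minimizer: "is_arg_min F (\<lambda>_. True) xs"
    and A0: "A 0 \<ge> 0"
    and \<gamma>0: "\<gamma> 0 > 0"
    and v0: "v 0 = x 0"
    and a_pos: "\<forall>j. a (Suc j) > 0"
    and L_pos: "\<forall>j. L (Suc j) > 0"
    and z_step: "\<forall>j. z (Suc j) = Tprox f \<Psi> (L (Suc j)) (y (Suc j))"
    and A_step: "\<forall>j. A (Suc j) = A j + a (Suc j)"
    and \<gamma>_step: "\<forall>j. \<gamma> (Suc j) = \<gamma> j + a (Suc j) * \<mu>"
    and v_step: "\<forall>j. v (Suc j) = (1 / \<gamma> (Suc j)) *\<^sub>R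
          (\<gamma> j *\<^sub>R v j
           + (a (Suc j) * (L (Suc j) + \<mu>\<Psi>)) *\<^sub>R z (Suc j)
           - (a (Suc j) * (L (Suc j) - \<mu>f)) *\<^sub>R y (Suc j))"
    and F_x_finite: "\<forall>j\<ge>1. F (x j) < \<infinity>"
    and F_x0_finite: "A 0 > 0 \<longrightarrow> F (x 0) < \<infinity>"
    and descent_x: "F (x (Suc k)) \<le> F (z (Suc k))"
    and descent_z: "F (z (Suc k)) \<le>
          ereal (Qmodel f (L (Suc k)) (y (Suc k)) (z (Suc k))) + \<Psi> (z (Suc k))"
  shows "\<Delta> (Suc k) + ereal \<A> + ereal \<B> \<le> \<Delta> k"
proof -
  define c G \<alpha> M Y' where "c = \<gamma> k" and "G = \<gamma> (Suc k)" and "\<alpha> = a (Suc k)"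
    and "M = L (Suc k) + \<mu>\<Psi>" and "Y' = y (Suc k)"
  define r p q where "r = x k - Y'" and "p = xs - Y'" and "q = v k - Y'"
  define W where "W = v (Suc k) - Y'"
  have \<mu>: "0 \<le> \<mu>" using \<mu>f_nonneg \<mu>\<Psi>_nonneg by (simp add: \<mu>_def)
  have \<gamma>_pos: "0 < \<gamma> j" for j
    by (induction j) (use \<gamma>0 \<gamma>_step a_pos \<mu> in \<open>simp_all add: add_pos_nonneg less_imp_le\<close>)
  have A_nonneg: "0 \<le> A j" for j
    by (induction j) (use A0 A_step a_pos in \<open>simp_all add: less_imp_le\<close>)
  have pos: "0 < c" "0 < G" "0 < \<alpha>" "0 < M"
    using \<gamma>_pos a_pos L_pos \<mu>\<Psi>_nonneg by (auto simp: c_def G_def \<alpha>_def M_def add_pos_nonneg)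
  have G_eq: "G = c + \<alpha> * \<mu>" using \<gamma>_step by (simp add: G_def c_def \<alpha>_def)

  have sc: "strongly_convex_ereal \<mu>\<Psi> \<Psi>" using \<Psi>_strong by (rule strongly_convex_erealI)
  have min: "ereal (Qmodel f (L (Suc k)) Y' (z (Suc k))) + \<Psi> (z (Suc k))
      \<le> ereal (Qmodel f (L (Suc k)) Y' w) + \<Psi> w" for w
    using Tprox_minimizes[OF _ \<mu>\<Psi>_nonneg sc \<Psi>_lsc, of "L (Suc k)"] L_pos \<Psi>_not_minf \<Psi>_proper z_step
    by (simp add: Y'_def)
  obtain u0 p0 where u0: "\<Psi> u0 = ereal p0" using \<Psi>_proper \<Psi>_not_minf by (metis ereal_cases)
  obtain pz where pz: "\<Psi> (z (Suc k)) = ereal pz"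
    using min[of u0] \<Psi>_not_minf u0 by (cases "\<Psi> (z (Suc k))") auto
  have "F xs \<le> F u0" using xs_minimizer by (auto simp: is_arg_min_def not_less)
  then obtain ps where ps: "\<Psi> xs = ereal ps"
    using \<Psi>_not_minf u0 by (cases "\<Psi> xs") (auto simp: F_def)
  obtain p1 where p1: "\<Psi> (x (Suc k)) = ereal p1"
    using F_x_finite[rule_format, of "Suc k"] \<Psi>_not_minf
    by (cases "\<Psi> (x (Suc k))") (auto simp: F_def)
  define Fx Fs where "Fx = f (x (Suc k)) + p1" and "Fs = f xs + ps"
  have Fx: "F (x (Suc k)) = ereal Fx" and Fs: "F xs = ereal Fs"
    by (simp_all add: F_def p1 ps Fx_def Fs_def)
  have descent: "Fx \<le> Qmodel f (L (Suc k)) Y' (z (Suc k)) + pz"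
    using order_trans[OF descent_x descent_z] by (simp add: Fx pz Y'_def)

  have lower: "Fx + (norm g)\<^sup>2 / (2 * M) + (inner g (u - Y') + \<mu> / 2 * (norm (u - Y'))\<^sup>2) \<le> f u + pu"
    if "\<Psi> u = ereal pu" for u pu
    using composite_gradient_lower_bound[OF _ f_strong sc _ min pz that descent, of g] f_diff pos(4)
    by (simp add: M_def g_def Y'_def \<mu>_def add.assoc)
  have at_xs: "\<alpha> * (Fx + (norm g)\<^sup>2 / (2 * M) + (inner g p + \<mu> / 2 * (norm p)\<^sup>2)) \<le> \<alpha> * Fs"
    using lower[OF ps] pos(3) by (simp add: p_def Fs_def)
  \<comment> \<open>Only for \<open>A\<^sub>0 = 0\<close> may \<open>F (x 0)\<close> be infinite; its weight then makes every term vanish.\<close>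
  obtain Fk where Fk: "ereal (A k) * (F (x k) - F xs) = ereal (A k * (Fk - Fs))"
    and at_xk: "A k * (Fx + (norm g)\<^sup>2 / (2 * M) + (inner g r + \<mu> / 2 * (norm r)\<^sup>2)) \<le> A k * Fk"
  proof (cases "A k = 0")
    case True
    then show ?thesis using that[of 0] by (simp flip: zero_ereal_def)
  next
    case False
    then have "F (x k) < \<infinity>"
      using F_x_finite F_x0_finite A_nonneg[of k] by (cases k) auto
    then obtain pk where pk: "\<Psi> (x k) = ereal pk"
      using \<Psi>_not_minf by (cases "\<Psi> (x k)") (auto simp: F_def)
    show ?thesis
    proof (rule that)
      show "ereal (A k) * (F (x k) - F xs) = ereal (A k * (f (x k) + pk - Fs))"
        by (simp add: Fs) (simp add: F_def pk)
      show "A k * (Fx + (norm g)\<^sup>2 / (2 * M) + (inner g r + \<mu> / 2 * (norm r)\<^sup>2)) \<le> A k * (f (x k) + pk)"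
        using lower[OF pk] A_nonneg[of k] by (intro mult_left_mono) (simp_all add: r_def)
    qed
  qed

  have W: "G *\<^sub>R W = c *\<^sub>R q - \<alpha> *\<^sub>R g"
  proof -
    have "G *\<^sub>R v (Suc k) = c *\<^sub>R v k + (\<alpha> * M) *\<^sub>R z (Suc k) - (\<alpha> * (L (Suc k) - \<mu>f)) *\<^sub>R Y'"
      using v_step pos(2) by (simp add: G_def c_def \<alpha>_def M_def Y'_def)
    then show ?thesis
      unfolding W_def q_def g_def scaleR_diff_right
      by (simp add: G_eq M_def \<mu>_def Y'_def algebra_simps)
  qed
  have s_eq: "s = (A k * G) *\<^sub>R r + (\<alpha> * c) *\<^sub>R q"
    by (simp add: s_def Y_def r_def q_def G_def c_def \<alpha>_def Y'_def algebra_simps)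
  have key: "G / 2 * (norm (W - p))\<^sup>2 - \<alpha>\<^sup>2 / (2 * G) * (norm g)\<^sup>2 + \<B>
      \<le> A k * (inner g r + \<mu> / 2 * (norm r)\<^sup>2) + \<alpha> * (inner g p + \<mu> / 2 * (norm p)\<^sup>2)
        + c / 2 * (norm (q - p))\<^sup>2"
    using estimate_function_update[OF pos(2) pos(1) pos(3) A_nonneg \<mu> G_eq W _ s_eq, of Y p]
    by (simp add: \<B>_def Y_def G_def c_def \<alpha>_def)
  have \<A>_eq: "\<A> = (A k + \<alpha>) * ((norm g)\<^sup>2 / (2 * M)) - \<alpha>\<^sup>2 / (2 * G) * (norm g)\<^sup>2"
  proof -
    have "\<A> = 1 / 2 * ((A k + \<alpha>) / M - \<alpha>\<^sup>2 / G) * (norm g)\<^sup>2"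
      using A_step by (simp add: \<A>_def M_def \<alpha>_def G_def)
    also have "\<dots> = (A k + \<alpha>) * ((norm g)\<^sup>2 / (2 * M)) - \<alpha>\<^sup>2 / (2 * G) * (norm g)\<^sup>2"
      using pos by (simp add: field_simps)
    finally show ?thesis .
  qed
  have real_ineq: "(A k + \<alpha>) * (Fx - Fs) + G / 2 * (norm (W - p))\<^sup>2 + \<A> + \<B>
      \<le> A k * (Fk - Fs) + c / 2 * (norm (q - p))\<^sup>2"
    using key at_xs at_xk unfolding \<A>_eq by (simp only: distrib_left distrib_right right_diff_distrib)
  have "\<Delta> (Suc k) = ereal ((A k + \<alpha>) * (Fx - Fs) + G / 2 * (norm (W - p))\<^sup>2)"
    using A_step by (simp add: \<Delta>_def Fx Fs G_def W_def p_def \<alpha>_def)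
  moreover have "\<Delta> k = ereal (A k * (Fk - Fs) + c / 2 * (norm (q - p))\<^sup>2)"
    by (simp add: \<Delta>_def Fk c_def q_def p_def)
  ultimately show ?thesis using real_ineq by simp
qed

end
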